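(* For every graph $G$ with $n$ vertices and every connected graph $H$ with $m$ vertices and minimum degree $\delta(H)\ge 2$, $$\gamma_{MR}(G\circ H)\le (m-4)\left\lceil \frac{n}{2}\right\rceil - m\left\lfloor \frac{n}{2}\right\rfloor+2n,$$ where $G\circ H$ is the corona of $G$ and $H$.
   Context: All graphs are finite and simple. For a vertex $v$ of $G=(V,E)$, $N[v]=\{v\}\cup\{u: uv\in E\}$ is the closed neighborhood, and for $f:V\to\mathbb{R}$ and $S\subseteq V$, $f(S)=\sum_{x\in S}f(x)$. A majority Roman dominating function (MRDF) on $G$ is a function $f:V\to\{-1,1,2\}$ such that (i) $f(N[v])\ge 1$ for at least half of the vertices $v\in V$, and (ii) every vertex $u$ with $f(u)=-1$ is adjacent to at least one vertex $w$ with $f(w)=2$. The weight of $f$ is $f(V)$, and the majority Roman domination number $\gamma_{MR}(G)$ is the minimum weight of an MRDF on $G$. The corona $G_1\circ G_2$ is the graph formed from one copy of $G_1$ and $|V(G_1)|$ copies of $G_2$ by making the $i$-th vertex of $G_1$ adjacent to every vertex of the $i$-th copy of $G_2$. *)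

theory Defs
  imports Complex_Main "HOL-Library.FuncSet" "Graph_Theory.Pair_Digraph"
    "Graph_Theory.Digraph_Component"
begin

text \<open>
  A finite simple graph is a \<open>pair_graph\<close>: a finite, loop-free digraph without parallel arcs
  whose arc set is symmetric, so that an edge \<open>uv\<close> is the pair of arcs \<open>(u, v)\<close>, \<open>(v, u)\<close>.
  In particular the out-degree of a vertex is its degree. The empty graph is a \<open>pair_graph\<close>,
  but it is not connected.
\<close>

definition closed_nbhd :: "'v pair_pre_digraph \<Rightarrow> 'v \<Rightarrow> 'v set" where
  "closed_nbhd G v = {v} \<union> {u. (u, v) \<in> parcs G}"

definition min_degree :: "'v pair_pre_digraph \<Rightarrow> nat" where
  "min_degree G = Min (out_degree (with_proj G) ` pverts G)"

text \<open>Only the values of \<open>f\<close> on the vertices of \<open>G\<close> matter below.\<close>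

definition MRDF :: "'v pair_pre_digraph \<Rightarrow> ('v \<Rightarrow> int) \<Rightarrow> bool" where
  "MRDF G f \<longleftrightarrow>
     f \<in> pverts G \<rightarrow> {-1, 1, 2} \<and>
     real (card {v \<in> pverts G. (\<Sum>x\<in>closed_nbhd G v. f x) \<ge> 1}) \<ge> real (card (pverts G)) / 2 \<and>
     (\<forall>u\<in>pverts G. f u = -1 \<longrightarrow> (\<exists>w\<in>pverts G. (u, w) \<in> parcs G \<and> f w = 2))"

definition weight :: "'v pair_pre_digraph \<Rightarrow> ('v \<Rightarrow> int) \<Rightarrow> int" where
  "weight G f = (\<Sum>v\<in>pverts G. f v)"

definition majority_roman_dom_number :: "'v pair_pre_digraph \<Rightarrow> int" where
  "majority_roman_dom_number G = Min {weight G f |f. MRDF G f}"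

text \<open>
  The vertices of \<open>G \<circ> H\<close> are \<open>Inl a\<close> for a vertex \<open>a\<close> of \<open>G\<close>, and \<open>Inr (a, x)\<close> for
  the vertex \<open>x\<close> in the copy of \<open>H\<close> that belongs to \<open>a\<close>.
\<close>

definition corona ::
  "'a pair_pre_digraph \<Rightarrow> 'b pair_pre_digraph \<Rightarrow> ('a + 'a \<times> 'b) pair_pre_digraph" where
  "corona G H =
     \<lparr> pverts = Inl ` pverts G \<union> Inr ` (pverts G \<times> pverts H),
       parcs = {(Inl a, Inl b) |a b. (a, b) \<in> parcs G}
             \<union> {(Inr (a, x), Inr (a, y)) |a x y. a \<in> pverts G \<and> (x, y) \<in> parcs H}
             \<union> {(Inl a, Inr (a, x)) |a x. a \<in> pverts G \<and> x \<in> pverts H}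
             \<union> {(Inr (a, x), Inl a) |a x. a \<in> pverts G \<and> x \<in> pverts H} \<rparr>"

text \<open>
  The corona is again a finite simple graph, and the minimum defining the majority Roman
  domination number is taken over a finite nonempty set.
\<close>

lemma pair_graph_corona:
  assumes "pair_graph G" and "pair_graph H"
  shows "pair_graph (corona G H)"
proof -
  interpret G: pair_graph G by fact
  interpret H: pair_graph H by fact
  have fv: "finite (pverts (corona G H))"
    by (simp add: corona_def G.pair_finite_verts H.pair_finite_verts)
  have wf: "fst e \<in> pverts (corona G H)" "snd e \<in> pverts (corona G H)"
    if "e \<in> parcs (corona G H)" for e
    using that by (auto simp: corona_def dest: G.wellformed' H.wellformed')
  have "parcs (corona G H) \<subseteq> pverts (corona G H) \<times> pverts (corona G H)"
    using wf by (auto simp: mem_Times_iff)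
  then have fa: "finite (parcs (corona G H))"
    using fv by (meson finite_SigmaI finite_subset)
  have "symmetric (with_proj (corona G H))"
    by (auto simp: symmetric_def sym_def corona_def
             intro: G.arcs_symmetric H.arcs_symmetric)
  moreover have "fst e \<noteq> snd e" if "e \<in> parcs (corona G H)" for e
    using that by (auto simp: corona_def dest: G.no_loops' H.no_loops')
  ultimately show ?thesis
    using fv fa wf by unfold_locales auto
qed

lemma MRDF_weights_finite_nonempty:
  assumes "pair_graph G"
  shows "finite {weight G f |f. MRDF G f}" and "{weight G f |f. MRDF G f} \<noteq> {}"
proof -
  interpret pair_graph G by fact
  have "{weight G f |f. MRDF G f} \<subseteq> {- int (card (pverts G)) .. 2 * int (card (pverts G))}"
  proof clarsimp
    fix f assume "MRDF G f"
    then have b: "- 1 \<le> f v \<and> f v \<le> 2" if "v \<in> pverts G" for v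
      using that by (force simp: MRDF_def Pi_iff)
    show "- int (card (pverts G)) \<le> weight G f \<and> weight G f \<le> 2 * int (card (pverts G))"
      using sum_bounded_below[of "pverts G" "-1" f] sum_bounded_above[of "pverts G" f 2] b
      by (simp add: weight_def mult.commute)
  qed
  then show "finite {weight G f |f. MRDF G f}"
    by (rule finite_subset) simp
  have "closed_nbhd G v \<subseteq> pverts G" if "v \<in> pverts G" for v
    using that by (auto simp: closed_nbhd_def dest: in_arcsD1)
  then have "finite (closed_nbhd G v)" if "v \<in> pverts G" for v
    using that pair_finite_verts finite_subset by metis
  then have "card (closed_nbhd G v) \<ge> 1" if "v \<in> pverts G" for v
    using that by (metis One_nat_def Suc_leI card_gt_0_iff closed_nbhd_def insert_not_empty
        insert_is_Un)
  then have "{v \<in> pverts G. (\<Sum>x\<in>closed_nbhd G v. 1::int) \<ge> 1} = pverts G"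
    by force
  then have "MRDF G (\<lambda>_. 1)"
    by (simp add: MRDF_def)
  then show "{weight G f |f. MRDF G f} \<noteq> {}" by blast
qed

end

(* Give every vertex of G the value 2. Over the ceiling of n/2 chosen vertices of G give two
   vertices of the copy of H the value -1 and the remaining ones the value 1; put -1 on all other
   copies. A closed neighbourhood in H has at least three vertices and meets the two negative ones
   at most twice, so together with the centre, of value 2, its sum is at least 2 + 3 - 4 = 1; a
   chosen centre has sum at least 2 + (m - 4), and m is at least 3. Hence all m + 1 vertices
   belonging to each chosen vertex of G are dominated, and these are at least half of all vertices. *)
theory Submission
  imports Defs
begin

lemma majority_roman_dom_number_le:
  assumes "pair_graph G" and "MRDF G f"
  shows "majority_roman_dom_number G \<le> weight G f"
  unfolding majority_roman_dom_number_def
  using MRDF_weights_finite_nonempty(1)[OF assms(1)] assms(2) by (intro Min_le) auto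

text \<open>Start from all ones, giving \<open>card S\<close>; each element of \<open>B\<close> met
  by \<open>S\<close> then lowers the sum by 2.\<close>

lemma sum_sign_eq:
  fixes S :: "'c set"
  assumes "finite S"
  shows "(\<Sum>y\<in>S. if y \<in> B then -1 else 1 :: int) = int (card S) - 2 * int (card (S \<inter> B))"
proof -
  have "S - (S - B) = S \<inter> B" by blast
  then have "int (card S) = int (card (S \<inter> B)) + int (card (S - B))"
    using assms by (metis card_Int_Diff of_nat_add)
  then show ?thesis
    using assms by (simp add: sum.If_cases Diff_eq)
qed

lemma (in pair_graph) closed_nbhd_subset_pverts:
  assumes "v \<in> pverts G"
  shows "closed_nbhd G v \<subseteq> pverts G"
  using assms by (auto simp: closed_nbhd_def dest: in_arcsD1)

lemma (in pair_graph) finite_closed_nbhd: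
  assumes "v \<in> pverts G"
  shows "finite (closed_nbhd G v)"
  using closed_nbhd_subset_pverts[OF assms] pair_finite_verts finite_subset by blast

text \<open>\<open>closed_nbhd\<close> collects tails of arcs into \<open>v\<close> while
  \<open>out_degree\<close> counts arcs out of \<open>v\<close>. Symmetry of the arc set identifies
  the two, and the absence of loops makes \<open>v\<close> itself the extra element.\<close>

lemma (in pair_graph) card_closed_nbhd:
  assumes "v \<in> pverts G"
  shows "card (closed_nbhd G v) = Suc (out_degree (with_proj G) v)"
proof -
  have fin: "finite {u. (u, v) \<in> parcs G}"
    using finite_closed_nbhd[OF assms] by (simp add: closed_nbhd_def)
  have "out_arcs (with_proj G) v = Pair v ` {u. (u, v) \<in> parcs G}"
    by (auto simp: out_arcs_def image_iff intro: arcs_symmetric)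
  then have "out_degree (with_proj G) v = card {u. (u, v) \<in> parcs G}"
    by (simp add: out_degree_def card_image inj_on_def)
  moreover have "v \<notin> {u. (u, v) \<in> parcs G}"
    by (auto dest: no_loops')
  ultimately show ?thesis
    using fin by (simp add: closed_nbhd_def)
qed

lemma min_degree_le_out_degree:
  assumes "finite (pverts G)" and "v \<in> pverts G"
  shows "min_degree G \<le> out_degree (with_proj G) v"
  using assms by (simp add: min_degree_def)

text \<open>A centre sees other centres and its own copy only, so negative copies elsewhere cannot
  lower its sum.\<close>

lemma closed_nbhd_corona_Inl:
  assumes "a \<in> pverts G"
  shows "closed_nbhd (corona G H) (Inl a)
           = Inl ` closed_nbhd G a \<union> Inr ` ({a} \<times> pverts H)"
  using assms by (auto simp: closed_nbhd_def corona_def)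

text \<open>The only way out of a copy is its centre, so the sum at a copy vertex is decided within
  its own block.\<close>

lemma closed_nbhd_corona_Inr:
  assumes "a \<in> pverts G" and "x \<in> pverts H"
  shows "closed_nbhd (corona G H) (Inr (a, x))
           = insert (Inl a) (Inr ` ({a} \<times> closed_nbhd H x))"
  using assms by (auto simp: closed_nbhd_def corona_def)

lemma sum_Inr_fibre:
  fixes f :: "'a + 'a \<times> 'b \<Rightarrow> int"
  shows "sum f (Inr ` ({a} \<times> S)) = (\<Sum>y\<in>S. f (Inr (a, y)))"
proof -
  have "Inr ` ({a} \<times> S) = (\<lambda>y. Inr (a, y) :: 'a + 'a \<times> 'b) ` S" by auto
  then show ?thesis by (simp add: sum.reindex inj_on_def)
qed

lemma card_pverts_corona:
  assumes "finite (pverts G)" and "finite (pverts H)"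
  shows "card (pverts (corona G H)) = card (pverts G) * (card (pverts H) + 1)"
proof -
  have "card (pverts (corona G H))
          = card (Inl ` pverts G :: ('a + 'a \<times> 'b) set)
          + card (Inr ` (pverts G \<times> pverts H) :: ('a + 'a \<times> 'b) set)"
    unfolding corona_def using assms by (simp, intro card_Un_disjoint) auto
  then show ?thesis by (simp add: card_image card_cartesian_product)
qed

text \<open>Grouping each centre with its copy suits labellings whose block totals depend only on
  the kind of centre.\<close>

lemma weight_corona:
  assumes "finite (pverts G)" and "finite (pverts H)"
  shows "weight (corona G H) f
           = (\<Sum>a\<in>pverts G. f (Inl a) + (\<Sum>x\<in>pverts H. f (Inr (a, x))))"
proof -
  have "weight (corona G H) f
          = sum f (Inl ` pverts G) + sum f (Inr ` (pverts G \<times> pverts H))"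
    unfolding weight_def corona_def using assms by (simp, intro sum.union_disjoint) auto
  also have "\<dots> = (\<Sum>a\<in>pverts G. f (Inl a)) + (\<Sum>p\<in>pverts G \<times> pverts H. f (Inr p))"
    by (simp add: sum.reindex)
  also have "(\<Sum>p\<in>pverts G \<times> pverts H. f (Inr p))
               = (\<Sum>a\<in>pverts G. \<Sum>x\<in>pverts H. f (Inr (a, x)))"
    by (simp add: sum.cartesian_product split_def)
  finally show ?thesis by (simp add: sum.distrib)
qed

text \<open>\<open>A\<close> is the set of chosen centres. The same set \<open>B\<close> of negative
  vertices is used in every chosen copy, so all chosen blocks have equal weight.\<close>

definition corona_labelling :: "'a set \<Rightarrow> 'b set \<Rightarrow> 'a + 'a \<times> 'b \<Rightarrow> int" where
  "corona_labelling A B v =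
     (case v of Inl a \<Rightarrow> 2 | Inr (a, x) \<Rightarrow> if a \<in> A \<and> x \<notin> B then 1 else -1)"

lemma corona_labelling_Inl [simp]: "corona_labelling A B (Inl a) = 2"
  by (simp add: corona_labelling_def)

lemma sum_corona_labelling_chosen:
  fixes B :: "'b set"
  assumes "a \<in> A" and "finite S"
  shows "(\<Sum>y\<in>S. corona_labelling A B (Inr (a, y))) = int (card S) - 2 * int (card (S \<inter> B))"
proof -
  have "(\<Sum>y\<in>S. corona_labelling A B (Inr (a, y))) = (\<Sum>y\<in>S. if y \<in> B then -1 else 1)"
    using assms(1) by (intro sum.cong) (auto simp: corona_labelling_def)
  then show ?thesis using sum_sign_eq[OF assms(2)] by simp
qed

lemma sum_corona_labelling_unchosen:
  assumes "a \<notin> A"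
  shows "(\<Sum>y\<in>S. corona_labelling A B (Inr (a, y))) = - int (card S)"
  using assms by (simp add: corona_labelling_def)

lemma weight_corona_labelling:
  assumes "finite (pverts G)" and "finite (pverts H)"
    and "A \<subseteq> pverts G" and "B \<subseteq> pverts H"
  shows "weight (corona G H) (corona_labelling A B)
           = 2 * int (card (pverts G))
           + int (card A) * (int (card (pverts H)) - 2 * int (card B))
           - int (card (pverts G - A)) * int (card (pverts H))"
proof -
  let ?g = "\<lambda>a. \<Sum>x\<in>pverts H. corona_labelling A B (Inr (a, x))"
  have "pverts H \<inter> B = B" using assms(4) by blast
  then have "sum ?g A = (\<Sum>a\<in>A. int (card (pverts H)) - 2 * int (card B))"
    using assms(2) by (intro sum.cong) (simp_all add: sum_corona_labelling_chosen)
  moreover have "sum ?g (pverts G - A) = (\<Sum>a\<in>pverts G - A. - int (card (pverts H)))"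
    by (intro sum.cong) (simp_all add: sum_corona_labelling_unchosen)
  ultimately show ?thesis
    using assms(1-3) sum.subset_diff[of A "pverts G" ?g]
    by (simp add: weight_corona sum.distrib)
qed

lemma MRDF_corona_labelling:
  assumes "pair_graph G" and "pair_graph H"
    and "min_degree H \<ge> 2" and "pverts H \<noteq> {}"
    and "A \<subseteq> pverts G" and "2 * card A \<ge> card (pverts G)"
    and "B \<subseteq> pverts H" and "card B = 2"
  shows "MRDF (corona G H) (corona_labelling A B)"
proof -
  interpret G: pair_graph G by fact
  interpret H: pair_graph H by fact
  let ?f = "corona_labelling A B" and ?K = "corona G H"
  let ?D = "{v \<in> pverts ?K. (\<Sum>x\<in>closed_nbhd ?K v. ?f x) \<ge> 1}"
  have finB: "finite B" using assms(8) card.infinite by fastforce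
  have card_nbhd: "card (closed_nbhd H x) \<ge> 3" if "x \<in> pverts H" for x
    using min_degree_le_out_degree[OF H.pair_finite_verts that] H.card_closed_nbhd[OF that] assms(3)
    by linarith
  obtain z where z: "z \<in> pverts H" using assms(4) by blast
  have card_H: "card (pverts H) \<ge> 3"
    using card_nbhd[OF z] card_mono[OF H.pair_finite_verts H.closed_nbhd_subset_pverts[OF z]]
    by linarith
  have centre: "Inl a \<in> ?D" if "a \<in> A" for a
  proof -
    have a: "a \<in> pverts G" using that assms(5) by blast
    note fin = G.finite_closed_nbhd[OF a]
    have "(\<Sum>x\<in>closed_nbhd ?K (Inl a). ?f x)
            = sum ?f (Inl ` closed_nbhd G a) + sum ?f (Inr ` ({a} \<times> pverts H))"
      unfolding closed_nbhd_corona_Inl[OF a] using fin H.pair_finite_verts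
      by (intro sum.union_disjoint) auto
    also have "\<dots> = 2 * int (card (closed_nbhd G a)) + (int (card (pverts H)) - 4)"
      using that H.pair_finite_verts assms(7,8)
      by (simp add: sum.reindex sum_Inr_fibre sum_corona_labelling_chosen Int_absorb1)
    \<comment> \<open>A closed neighbourhood is never empty, so the first term is at least 2 even
      for an isolated \<open>a\<close>; the second is at least -1 since \<open>H\<close> has at
      least three vertices.\<close>
    finally show ?thesis
      using card_H a by (simp add: G.card_closed_nbhd corona_def)
  qed
  have leaf: "Inr (a, x) \<in> ?D" if "a \<in> A" "x \<in> pverts H" for a x
  proof -
    have a: "a \<in> pverts G" using that assms(5) by blast
    note fin = H.finite_closed_nbhd[OF that(2)]
    have "(\<Sum>v\<in>closed_nbhd ?K (Inr (a, x)). ?f v)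
            = 2 + (int (card (closed_nbhd H x)) - 2 * int (card (closed_nbhd H x \<inter> B)))"
      unfolding closed_nbhd_corona_Inr[OF a that(2)] using fin that(1)
      by (subst sum.insert) (auto simp: sum_Inr_fibre sum_corona_labelling_chosen)
    \<comment> \<open>Only the size of \<open>B\<close> enters, so its two vertices may lie anywhere
      in \<open>H\<close>.\<close>
    moreover have "card (closed_nbhd H x \<inter> B) \<le> 2"
      using card_mono[OF finB, of "closed_nbhd H x \<inter> B"] assms(8) by simp
    ultimately have "(\<Sum>v\<in>closed_nbhd ?K (Inr (a, x)). ?f v) \<ge> 1"
      using card_nbhd[OF that(2)] by linarith
    then show ?thesis using a that(2) by (simp add: corona_def)
  qed
  have finA: "finite A" using assms(5) G.pair_finite_verts finite_subset by blast
  have "Inl ` A \<union> Inr ` (A \<times> pverts H) \<subseteq> ?D" using centre leaf by blast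
  moreover have "finite ?D" using G.pair_finite_verts H.pair_finite_verts by (simp add: corona_def)
  ultimately have "card (Inl ` A \<union> Inr ` (A \<times> pverts H) :: ('a + 'a \<times> 'b) set) \<le> card ?D"
    by (intro card_mono)
  moreover have "card (Inl ` A \<union> Inr ` (A \<times> pverts H) :: ('a + 'a \<times> 'b) set)
                   = card A * (card (pverts H) + 1)"
    using finA H.pair_finite_verts
    by (subst card_Un_disjoint) (auto simp: card_image card_cartesian_product)
  ultimately have "2 * card A * (card (pverts H) + 1) \<le> 2 * card ?D" by simp
  \<comment> \<open>All blocks have the same size, so half of the centres account for half of the
    vertices.\<close>
  moreover have "card (pverts ?K) \<le> 2 * card A * (card (pverts H) + 1)"
    unfolding card_pverts_corona[OF G.pair_finite_verts H.pair_finite_verts]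
    using assms(6) by (rule mult_le_mono1)
  ultimately have half: "real (card ?D) \<ge> real (card (pverts ?K)) / 2" by linarith
  \<comment> \<open>Centres carry 2, so a vertex of value -1 lies in a copy, and the centre of that
    copy is the witness.\<close>
  have "\<exists>w\<in>pverts ?K. (u, w) \<in> parcs ?K \<and> ?f w = 2"
    if "u \<in> pverts ?K" "?f u = -1" for u
  proof (cases u)
    case (Inl a)
    then show ?thesis using that(2) by simp
  next
    case (Inr p)
    then show ?thesis using that(1)
      by (cases p) (auto simp: corona_def intro!: bexI[of _ "Inl (fst p)"])
  qed
  moreover have "?f \<in> pverts ?K \<rightarrow> {-1, 1, 2}"
    by (auto simp: corona_labelling_def split: sum.split)
  ultimately show ?thesis unfolding MRDF_def using half by blast
qed

theorem theorem20:
  fixes G :: "'a pair_pre_digraph" and H :: "'b pair_pre_digraph" and n m :: nat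
  assumes "pair_graph G" and "card (pverts G) = n"
    and "pair_graph H" and "card (pverts H) = m"
    and "Digraph_Component.connected (with_proj H)"
    and "min_degree H \<ge> 2"
  shows "majority_roman_dom_number (corona G H)
           \<le> (int m - 4) * \<lceil>real n / 2\<rceil> - int m * \<lfloor>real n / 2\<rfloor> + 2 * int n"
proof -
  interpret G: pair_graph G by fact
  interpret H: pair_graph H by fact
  \<comment> \<open>Strong connectivity includes having a vertex. This is needed first, since
    \<open>min_degree\<close> of an empty graph is an unspecified \<open>Min {}\<close>.\<close>
  have ne: "pverts H \<noteq> {}"
    using assms(5) by (auto simp: connected_def strongly_connected_def)
  then obtain z where z: "z \<in> pverts H" by blast
  have "card (closed_nbhd H z) \<le> m"
    using card_mono[OF H.pair_finite_verts H.closed_nbhd_subset_pverts[OF z]] assms(4) by simp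
  then have "2 \<le> card (pverts H)"
    using min_degree_le_out_degree[OF H.pair_finite_verts z] H.card_closed_nbhd[OF z] assms(4,6)
    by linarith
  then obtain B where B: "B \<subseteq> pverts H" "card B = 2"
    by (meson obtain_subset_with_card_n)
  \<comment> \<open>This is the least size of \<open>A\<close> with
    \<open>2 * card A \<ge> n\<close>. Smaller is better: the copy over a chosen centre has weight
    \<open>m - 4\<close>, over any other \<open>-m\<close>, and \<open>m \<ge> 3\<close>.\<close>
  have "(n + 1) div 2 \<le> card (pverts G)" using assms(2) by linarith
  then obtain A where A: "A \<subseteq> pverts G" "card A = (n + 1) div 2"
    by (meson obtain_subset_with_card_n)
  have "MRDF (corona G H) (corona_labelling A B)"
    using assms A B ne by (intro MRDF_corona_labelling) auto
  then have "majority_roman_dom_number (corona G H) \<le> weight (corona G H) (corona_labelling A B)"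
    by (rule majority_roman_dom_number_le[OF pair_graph_corona[OF assms(1,3)]])
  moreover have "card (pverts G - A) = n div 2"
    using A assms(2) card_Diff_subset[of A "pverts G"] finite_subset[OF A(1) G.pair_finite_verts]
    by simp
  moreover have "\<lceil>real n / 2\<rceil> = int ((n + 1) div 2)" by linarith
  moreover have "\<lfloor>real n / 2\<rfloor> = int (n div 2)" by linarith
  ultimately show ?thesis
    using A B assms(2,4) weight_corona_labelling[OF G.pair_finite_verts H.pair_finite_verts A(1) B(1)]
    by (simp add: algebra_simps)
qed

end
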